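(* Every finite projective plane, of any order, admits a legitimate coloring with $42$ colors.
   Context: A finite projective plane of order $n$ has point set $P$ and line set $L$ with $|P|=|L|=n^2+n+1$, each line (viewed as a set of points) having $n+1$ points and each point lying on $n+1$ lines; degenerate planes are excluded by requiring four points no three of which are on a common line. For a coloring $g:P\to\{1,\dots,c\}$, the type of a line $\ell$ is the vector $(|\ell\cap g^{-1}(1)|,\dots,|\ell\cap g^{-1}(c)|)$. A coloring with $c$ colors is legitimate if distinct lines have distinct types. *)

theory Defs
  imports "HOL-Library.FuncSet"
begin

text \<open>
  Lines are sets of points. The order is not a parameter of the locale: it is determined by the
  axioms, and the usual cardinalities are derived in \<open>ex1_order\<close> below.
\<close>

locale finite_projective_plane =
  fixes P :: "'a set" and L :: "'a set set"
  assumes finite_points: "finite P"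
    and lines_subset: "l \<in> L \<Longrightarrow> l \<subseteq> P"
    and unique_join: "\<lbrakk>p \<in> P; q \<in> P; p \<noteq> q\<rbrakk> \<Longrightarrow> \<exists>!l. l \<in> L \<and> p \<in> l \<and> q \<in> l"
    and unique_meet: "\<lbrakk>l \<in> L; m \<in> L; l \<noteq> m\<rbrakk> \<Longrightarrow> \<exists>!p. p \<in> l \<and> p \<in> m"
    and quadrangle: "\<exists>Q \<subseteq> P. card Q = 4 \<and> (\<forall>l\<in>L. card (l \<inter> Q) \<le> 2)"

definition line_type :: "nat \<Rightarrow> ('a \<Rightarrow> nat) \<Rightarrow> 'a set \<Rightarrow> nat list" where
  "line_type c g l = map (\<lambda>i. card (l \<inter> g -` {i})) [1..<c + 1]"

text \<open>A coloring need not use all \<open>c\<close> colors.\<close>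

definition legitimate_coloring :: "'a set \<Rightarrow> 'a set set \<Rightarrow> nat \<Rightarrow> ('a \<Rightarrow> nat) \<Rightarrow> bool" where
  "legitimate_coloring P L c g \<longleftrightarrow>
     g \<in> P \<rightarrow> {1..c} \<and> (\<forall>l\<in>L. \<forall>m\<in>L. l \<noteq> m \<longrightarrow> line_type c g l \<noteq> line_type c g m)"

context finite_projective_plane
begin

lemma finite_line: "l \<in> L \<Longrightarrow> finite l"
  using finite_points lines_subset finite_subset by blast

lemma finite_lines: "finite L"
  using finite_points lines_subset by (meson Pow_iff finite_Pow_iff finite_subset subsetI)

lemma join_eq: "\<lbrakk>l \<in> L; m \<in> L; p \<in> l; p \<in> m; q \<in> l; q \<in> m; p \<noteq> q\<rbrakk> \<Longrightarrow> l = m"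
  using unique_meet[of l m] by blast

lemma join_ex: "\<lbrakk>p \<in> P; q \<in> P; p \<noteq> q\<rbrakk> \<Longrightarrow> \<exists>l\<in>L. p \<in> l \<and> q \<in> l"
  using unique_join[of p q] by blast

lemma meet_ex: "\<lbrakk>l \<in> L; m \<in> L; l \<noteq> m\<rbrakk> \<Longrightarrow> \<exists>p\<in>P. p \<in> l \<and> p \<in> m"
  using unique_meet[of l m] lines_subset[of l] by blast

lemma quadrangle_points:
  obtains a b c d where "{a, b, c, d} \<subseteq> P" "distinct [a, b, c, d]"
    "\<And>l x y z. \<lbrakk>l \<in> L; {x, y, z} \<subseteq> {a, b, c, d}; x \<in> l; y \<in> l; z \<in> l; x \<noteq> y; x \<noteq> z; y \<noteq> z\<rbrakk> \<Longrightarrow> False"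
proof -
  obtain Q where Q: "Q \<subseteq> P" "card Q = 4" "\<And>l. l \<in> L \<Longrightarrow> card (l \<inter> Q) \<le> 2"
    using quadrangle by blast
  have fQ: "finite Q" using Q(2) card.infinite by fastforce
  obtain xs where xs: "set xs = Q" "distinct xs"
    using finite_distinct_list[OF fQ] by blast
  have "length xs = 4" using xs Q(2) distinct_card by fastforce
  then obtain a b c d where abcd: "xs = [a, b, c, d]"
    by (auto simp: length_Suc_conv eval_nat_numeral)
  have "False" if "l \<in> L" "{x, y, z} \<subseteq> Q" "x \<in> l" "y \<in> l" "z \<in> l" "x \<noteq> y" "x \<noteq> z" "y \<noteq> z" for l x y z
  proof -
    have "card {x, y, z} \<le> card (l \<inter> Q)"
      using that fQ by (intro card_mono) auto
    moreover have "card {x, y, z} = 3" using that by auto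
    ultimately show False using Q(3)[OF that(1)] by simp
  qed
  moreover have "Q = {a, b, c, d}" using xs abcd by auto
  ultimately show thesis
    using that[of a b c d] Q(1) xs(2) abcd by metis
qed

lemma ex_line_not_through:
  shows "\<exists>l\<in>L. p \<notin> l"
proof (rule ccontr)
  assume "\<not> ?thesis"
  then have all: "\<And>l. l \<in> L \<Longrightarrow> p \<in> l" by blast
  obtain a b c d where Q: "{a, b, c, d} \<subseteq> P" "distinct [a, b, c, d]"
    "\<And>l x y z. \<lbrakk>l \<in> L; {x, y, z} \<subseteq> {a, b, c, d}; x \<in> l; y \<in> l; z \<in> l; x \<noteq> y; x \<noteq> z; y \<noteq> z\<rbrakk> \<Longrightarrow> False"
    using quadrangle_points by metis
  have key: False if xyz: "{x, y, z} \<subseteq> {a, b, c, d}" "x \<noteq> y" "x \<noteq> z" "y \<noteq> z" "p \<noteq> y" for x y z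
  proof -
    have P: "x \<in> P" "y \<in> P" "z \<in> P" using xyz(1) Q(1) by auto
    obtain l where l: "l \<in> L" "x \<in> l" "y \<in> l" using join_ex P xyz by metis
    obtain m where m: "m \<in> L" "y \<in> m" "z \<in> m" using join_ex P xyz by metis
    have "l = m" using join_eq[of l m p y] l m all xyz(5) by blast
    then show False using Q(3)[of l x y z] l m xyz by metis
  qed
  show False
    using key[of a b c] key[of b a c] Q(2) by auto
qed

lemma ex_point_off_two:
  assumes "l \<in> L" "m \<in> L"
  shows "\<exists>q\<in>P. q \<notin> l \<and> q \<notin> m"
proof (rule ccontr)
  assume "\<not> ?thesis"
  then have all: "\<And>q. q \<in> P \<Longrightarrow> q \<in> l \<or> q \<in> m" by blast
  obtain a b c d where Q: "{a, b, c, d} \<subseteq> P" "distinct [a, b, c, d]"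
    "\<And>l x y z. \<lbrakk>l \<in> L; {x, y, z} \<subseteq> {a, b, c, d}; x \<in> l; y \<in> l; z \<in> l; x \<noteq> y; x \<noteq> z; y \<noteq> z\<rbrakk> \<Longrightarrow> False"
    using quadrangle_points by metis
  have key: False
    if xs: "{x, y, z, w} \<subseteq> {a, b, c, d}" "distinct [x, y, z, w]"
      and lm: "x \<in> l" "y \<in> l" "z \<in> m" "w \<in> m" for x y z w
  proof -
    have P: "x \<in> P" "y \<in> P" "z \<in> P" "w \<in> P" using xs(1) Q(1) by auto
    obtain u where u: "u \<in> L" "x \<in> u" "z \<in> u" using join_ex[OF P(1,3)] xs(2) by auto
    obtain v where v: "v \<in> L" "y \<in> v" "w \<in> v" using join_ex[OF P(2,4)] xs(2) by auto
    have tri: False if "k \<in> L" "{r, s, t} \<subseteq> {x, y, z, w}" "r \<in> k" "s \<in> k" "t \<in> k"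
      "r \<noteq> s" "r \<noteq> t" "s \<noteq> t" for k r s t
      by (rule Q(3)[OF that(1) subset_trans[OF that(2) xs(1)] that(3-8)])
    have neq: "x \<noteq> y" "x \<noteq> z" "x \<noteq> w" "y \<noteq> z" "y \<noteq> w" "z \<noteq> w"
      using xs(2) by auto
    have ne: "y \<notin> u" "z \<notin> l" "x \<notin> m" "x \<notin> v" "z \<notin> v"
      using tri[of u x z y] tri[of l x y z] tri[of m z w x] tri[of v x y w] tri[of v y z w] u v lm neq assms by blast+
    have "u \<noteq> v" using v ne by blast
    then obtain e where e: "e \<in> P" "e \<in> u" "e \<in> v" using meet_ex[of u v] u v by blast
    have "e \<notin> l" using join_eq[of u l e x] assms u ne e lm by metis
    moreover have "e \<notin> m" using join_eq[of u m e z] assms u ne e lm by metis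
    ultimately show False using all e by blast
  qed
  have c3: "\<not> (x \<in> k \<and> y \<in> k \<and> z \<in> k)"
    if "k = l \<or> k = m" "{x, y, z} \<subseteq> {a, b, c, d}" "x \<noteq> y" "x \<noteq> z" "y \<noteq> z" for k x y z
    using Q(3)[of k x y z] that assms by blast
  have A: "a \<in> l \<or> a \<in> m" "b \<in> l \<or> b \<in> m" "c \<in> l \<or> c \<in> m" "d \<in> l \<or> d \<in> m"
    using all Q(1) by auto
  have T: "\<not> (a \<in> k \<and> b \<in> k \<and> c \<in> k)" "\<not> (a \<in> k \<and> b \<in> k \<and> d \<in> k)"
    "\<not> (a \<in> k \<and> c \<in> k \<and> d \<in> k)" "\<not> (b \<in> k \<and> c \<in> k \<and> d \<in> k)"
    if "k = l \<or> k = m" for k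
    using c3[OF that, of a b c] c3[OF that, of a b d] c3[OF that, of a c d] c3[OF that, of b c d] Q(2)
    by auto
  have K: "\<not> (a \<in> l \<and> b \<in> l \<and> c \<in> m \<and> d \<in> m)" "\<not> (a \<in> l \<and> c \<in> l \<and> b \<in> m \<and> d \<in> m)"
    "\<not> (a \<in> l \<and> d \<in> l \<and> b \<in> m \<and> c \<in> m)" "\<not> (b \<in> l \<and> c \<in> l \<and> a \<in> m \<and> d \<in> m)"
    "\<not> (b \<in> l \<and> d \<in> l \<and> a \<in> m \<and> c \<in> m)" "\<not> (c \<in> l \<and> d \<in> l \<and> a \<in> m \<and> b \<in> m)"
    using key[of a b c d] key[of a c b d] key[of a d b c] key[of b c a d] key[of b d a c]
      key[of c d a b] Q(2) by auto
  show False using A K T[of l, simplified] T[of m, simplified] by argo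
qed

lemma card_pencil:
  assumes "p \<in> P" "l \<in> L" "p \<notin> l"
  shows "card {m \<in> L. p \<in> m} = card l"
proof -
  have "bij_betw (\<lambda>m. THE x. x \<in> m \<and> x \<in> l) {m \<in> L. p \<in> m} l"
  proof (rule bij_betwI')
    have the: "(THE x. x \<in> m \<and> x \<in> l) \<in> m \<and> (THE x. x \<in> m \<and> x \<in> l) \<in> l"
      if "m \<in> L" "p \<in> m" for m
      using theI'[OF unique_meet[of m l]] that assms by metis
    show "((THE x. x \<in> m \<and> x \<in> l) = (THE x. x \<in> m' \<and> x \<in> l)) = (m = m')"
      if "m \<in> {m \<in> L. p \<in> m}" "m' \<in> {m \<in> L. p \<in> m}" for m m'
      using the[of m] the[of m'] that assms join_eq[of m m' p "THE x. x \<in> m \<and> x \<in> l"] by force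
    show "(THE x. x \<in> m \<and> x \<in> l) \<in> l" if "m \<in> {m \<in> L. p \<in> m}" for m
      using the that by blast
    show "\<exists>m\<in>{m \<in> L. p \<in> m}. x = (THE x. x \<in> m \<and> x \<in> l)" if x: "x \<in> l" for x
    proof -
      obtain m where m: "m \<in> L" "p \<in> m" "x \<in> m"
        using join_ex[of p x] assms x lines_subset by blast
      have "(THE x. x \<in> m \<and> x \<in> l) = x"
        using the1_equality[OF unique_meet[of m l]] m x assms by metis
      then show ?thesis using m by force
    qed
  qed
  then show ?thesis by (rule bij_betw_same_card)
qed

lemma card_line_eq:
  assumes "l \<in> L" "m \<in> L"
  shows "card l = card m"
proof -
  obtain q where "q \<in> P" "q \<notin> l" "q \<notin> m"
    using ex_point_off_two[OF assms] by blast
  then show ?thesis using card_pencil[of q l] card_pencil[of q m] assms by simp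
qed

lemma ex1_order:
  "\<exists>!n. card P = n\<^sup>2 + n + 1 \<and> card L = n\<^sup>2 + n + 1 \<and>
     (\<forall>l\<in>L. card l = n + 1) \<and> (\<forall>p\<in>P. card {l \<in> L. p \<in> l} = n + 1)"
proof -
  obtain x y where xy: "x \<in> P" "y \<in> P" "x \<noteq> y"
  proof (rule quadrangle_points)
    fix a b c d assume "{a, b, c, d} \<subseteq> P" "distinct [a, b, c, d]"
    then show thesis using that[of a b] by simp
  qed
  obtain l where l: "l \<in> L" and x: "x \<in> l" using join_ex[OF xy] by blast
  obtain p where p: "p \<in> P" "p \<notin> l" using ex_point_off_two[OF l l] by blast
  have "card l > 0" using x finite_line[OF l] card_gt_0_iff by blast
  then obtain n where n: "card l = n + 1" by (metis Suc_eq_plus1 gr0_implies_Suc)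
  have cl: "\<forall>k\<in>L. card k = n + 1" using card_line_eq[OF _ l] n by simp
  have cp: "\<forall>q\<in>P. card {k \<in> L. q \<in> k} = n + 1"
  proof
    fix q assume q: "q \<in> P"
    obtain k where "k \<in> L" "q \<notin> k" using ex_line_not_through by blast
    then show "card {k \<in> L. q \<in> k} = n + 1" using card_pencil[of q k] q cl by simp
  qed
  have un: "P - {p} = (\<Union>k\<in>{k \<in> L. p \<in> k}. k - {p})"
    using join_ex[OF p(1)] lines_subset by blast
  have "card (P - {p}) = (\<Sum>k\<in>{k \<in> L. p \<in> k}. card (k - {p}))"
    unfolding un
  proof (rule card_UN_disjoint)
    show "finite {k \<in> L. p \<in> k}" using finite_lines by simp
    show "\<forall>k\<in>{k \<in> L. p \<in> k}. finite (k - {p})" using finite_line by blast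
    show "\<forall>i\<in>{k \<in> L. p \<in> k}. \<forall>j\<in>{k \<in> L. p \<in> k}. i \<noteq> j \<longrightarrow> (i - {p}) \<inter> (j - {p}) = {}"
      using join_eq by blast
  qed
  also have "\<dots> = (\<Sum>k\<in>{k \<in> L. p \<in> k}. n)"
    using cl finite_line by (intro sum.cong) auto
  also have "\<dots> = (n + 1) * n" using cp p by simp
  finally have cP: "card P = n\<^sup>2 + n + 1"
    using p finite_points by (simp add: card_Diff_singleton_if power2_eq_square algebra_simps)
      (metis Suc_pred card_gt_0_iff emptyE)
  have "(\<Sum>k\<in>L. card {q \<in> P. q \<in> k}) = (n + 1) * card P"
    using sum_multicount[of L P "\<lambda>k q. q \<in> k" "n + 1"] finite_lines finite_points cp by simp
  moreover have "card {q \<in> P. q \<in> k} = n + 1" if "k \<in> L" for k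
  proof -
    have "{q \<in> P. q \<in> k} = k" using lines_subset that by blast
    then show ?thesis using cl that by simp
  qed
  ultimately have "card L * (n + 1) = (n + 1) * card P" by simp
  then have cL: "card L = n\<^sup>2 + n + 1" using cP
    by (metis mult.commute mult_cancel1 add_is_0 one_neq_zero)
  show ?thesis
  proof (rule ex1I[of _ n])
    show "card P = n\<^sup>2 + n + 1 \<and> card L = n\<^sup>2 + n + 1 \<and>
     (\<forall>l\<in>L. card l = n + 1) \<and> (\<forall>p\<in>P. card {l \<in> L. p \<in> l} = n + 1)"
      using cP cL cl cp by blast
    show "n' = n" if "card P = n'\<^sup>2 + n' + 1 \<and> card L = n'\<^sup>2 + n' + 1 \<and>
     (\<forall>l\<in>L. card l = n' + 1) \<and> (\<forall>p\<in>P. card {l \<in> L. p \<in> l} = n' + 1)" for n'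
      using that l n by simp
  qed
qed

end

end

theory Submission
  imports Defs Complex_Main
begin

text \<open>
  Color the points uniformly at random with \<open>c = 42\<close> colors. For lines \<open>l \<noteq> m\<close> of a plane of
  order \<open>n\<close>, fix the colors off \<open>l - m\<close>: then equality of the types prescribes the numbers of
  points of each color in the \<open>n\<close>-element set \<open>l - m\<close>, which happens with probability at most the
  largest multinomial probability. Since some prescribed number \<open>k i\<close> is at least \<open>n / c\<close>,
  double counting the points of color \<open>i\<close> gives a recursion for that probability; it decays so
  fast that the union bound over all pairs of lines succeeds for every \<open>n\<close>.
\<close>

text \<open>
  The largest probability of a single outcome of a uniform multinomial distribution with \<open>n\<close>
  trials and \<open>c\<close> outcomes per trial. The quotient \<open>n div c + 1\<close> is \<open>(n + 1) / c\<close> rounded up.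
\<close>

primrec mode_prob :: "nat \<Rightarrow> nat \<Rightarrow> real" where
  "mode_prob c 0 = 1"
| "mode_prob c (Suc n) = mode_prob c n * (real (n + 1) / (real c * real (n div c + 1)))"

lemma mode_prob_nonneg: "mode_prob c n \<ge> 0"
  by (induction n) auto

section \<open>Colorings with prescribed color counts\<close>

text \<open>For finite \<open>A\<close> and \<open>C\<close>, its size is the multinomial
  coefficient of \<open>k\<close> if \<open>sum k C = card A\<close>, and 0 otherwise.\<close>

definition colorings_with_counts :: "'a set \<Rightarrow> 'b set \<Rightarrow> ('b \<Rightarrow> nat) \<Rightarrow> ('a \<Rightarrow> 'b) set" where
  "colorings_with_counts A C k = {f \<in> A \<rightarrow>\<^sub>E C. \<forall>i\<in>C. card {x \<in> A. f x = i} = k i}"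

lemma finite_colorings_with_counts:
  "finite A \<Longrightarrow> finite C \<Longrightarrow> finite (colorings_with_counts A C k)"
  by (simp add: colorings_with_counts_def finite_PiE)

lemma sum_counts:
  assumes "finite A" "finite C" "f \<in> colorings_with_counts A C k"
  shows "sum k C = card A"
proof -
  have "card A = (\<Sum>i\<in>C. card {x \<in> A. f x = i})"
    using sum.group[of A C f "\<lambda>_. 1 :: nat"] assms
    by (simp add: colorings_with_counts_def PiE_def Pi_iff image_subset_iff)
  then show ?thesis using assms by (simp add: colorings_with_counts_def)
qed

text \<open>Deleting the point \<open>a\<close> loses no information, because its color is known. If
  \<open>k i = 0\<close>, the left-hand set is empty, so the truncated \<open>k i - 1\<close> does
  no harm.\<close>

lemma card_colorings_with_counts_fix_le:
  assumes "finite A" "finite C" "a \<in> A" "i \<in> C"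
  shows "card {f \<in> colorings_with_counts A C k. f a = i}
    \<le> card (colorings_with_counts (A - {a}) C (k(i := k i - 1)))"
proof (rule card_inj_on_le)
  let ?r = "\<lambda>f. restrict f (A - {a})"
  show "finite (colorings_with_counts (A - {a}) C (k(i := k i - 1)))"
    using assms by (simp add: finite_colorings_with_counts)
  show "inj_on ?r {f \<in> colorings_with_counts A C k. f a = i}"
  proof (rule inj_onI, rule ext)
    fix f g x
    assume fg: "f \<in> {f \<in> colorings_with_counts A C k. f a = i}"
      "g \<in> {f \<in> colorings_with_counts A C k. f a = i}" "?r f = ?r g"
    have "f \<in> A \<rightarrow>\<^sub>E C" "g \<in> A \<rightarrow>\<^sub>E C" "f a = g a"
      using fg(1,2) by (simp_all add: colorings_with_counts_def)
    moreover from this have "f x = undefined" "g x = undefined" if "x \<notin> A"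
      using that by (blast intro: PiE_arb)+
    ultimately show "f x = g x"
      using fun_cong[OF fg(3), of x] by (cases "x \<in> A"; cases "x = a") simp_all
  qed
  show "?r ` {f \<in> colorings_with_counts A C k. f a = i}
    \<subseteq> colorings_with_counts (A - {a}) C (k(i := k i - 1))"
  proof clarify
    fix f assume f: "f \<in> colorings_with_counts A C k" "i = f a"
    have "card {x \<in> A - {a}. ?r f x = j} = (k(i := k i - 1)) j" if j: "j \<in> C" for j
    proof -
      have eq: "{x \<in> A - {a}. ?r f x = j} = {x \<in> A. f x = j} - {a}" by auto
      have "card {x \<in> A. f x = j} = k j"
        using f(1) j by (simp add: colorings_with_counts_def)
      then show ?thesis
        unfolding eq using assms f(2) by (auto simp: card_Diff_singleton_if)
    qed
    then show "?r f \<in> colorings_with_counts (A - {a}) C (k(f a := k (f a) - 1))"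
      using f by (auto simp: colorings_with_counts_def)
  qed
qed

text \<open>Pairs of a coloring \<open>f\<close> and a point \<open>a\<close> with
  \<open>f a = i\<close> are counted twice: by colorings this gives \<open>k i\<close> each, by
  points the induction hypothesis applies to \<open>A - {a}\<close>. Choosing \<open>i\<close> with
  \<open>k i\<close> at least the rounded-up average yields the factor in
  \<open>mode_prob\<close>.\<close>

lemma card_colorings_with_counts_le:
  assumes "finite A" "finite C" "C \<noteq> {}"
  shows "real (card (colorings_with_counts A C k))
    \<le> mode_prob (card C) (card A) * real (card C) ^ card A"
  using assms(1)
proof (induction "card A" arbitrary: A k)
  case 0
  have "card (colorings_with_counts A C k) \<le> card (A \<rightarrow>\<^sub>E C)"
    using 0 assms by (intro card_mono) (auto simp: colorings_with_counts_def finite_PiE)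
  also have "\<dots> = 1" using 0 by simp
  finally show ?case using 0 by simp
next
  case (Suc n)
  let ?c = "card C" and ?T = "colorings_with_counts A C k"
  have c: "?c > 0" using assms by (simp add: card_gt_0_iff)
  show ?case
  \<comment> \<open>Only an actual coloring guarantees \<open>sum k C = Suc n\<close>, on which the
    pigeonhole choice of \<open>i\<close> rests.\<close>
  proof (cases "?T = {}")
    case True
    then show ?thesis by (simp add: mode_prob_nonneg del: mode_prob.simps)
  next
    case False
    then have sum: "sum k C = Suc n"
      using sum_counts Suc assms by (metis ex_in_conv)
    have "\<exists>i\<in>C. n div ?c + 1 \<le> k i"
    proof (rule ccontr)
      assume "\<not> ?thesis"
      then have "sum k C \<le> (\<Sum>i\<in>C. n div ?c)" by (intro sum_mono) auto
      also have "\<dots> \<le> n" by simp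
      finally show False using sum by simp
    qed
    then obtain i where i: "i \<in> C" "n div ?c + 1 \<le> k i" by blast
    have fin: "finite ?T" using Suc assms by (simp add: finite_colorings_with_counts)
    have "k i * card ?T = (\<Sum>f\<in>?T. card {x \<in> A. f x = i})"
      using i by (simp add: colorings_with_counts_def)
    also have "\<dots> = (\<Sum>a\<in>A. card {f \<in> ?T. f a = i})"
      using sum_multicount_gen[of ?T A "\<lambda>f x. f x = i" "\<lambda>a. card {f \<in> ?T. f a = i}"]
        fin Suc by simp
    finally have double: "k i * card ?T = (\<Sum>a\<in>A. card {f \<in> ?T. f a = i})" .
    have "real (n div ?c + 1) * real (card ?T) \<le> real (k i * card ?T)"
      using mult_le_mono1[OF i(2), of "card ?T"] by (simp only: of_nat_mult[symmetric] of_nat_le_iff)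
    also have "\<dots> = (\<Sum>a\<in>A. real (card {f \<in> ?T. f a = i}))" by (simp add: double)
    also have "\<dots> \<le> (\<Sum>a\<in>A. mode_prob ?c n * real ?c ^ n)"
    proof (rule sum_mono)
      fix a assume a: "a \<in> A"
      have ca: "n = card (A - {a})" using a Suc by simp
      have "real (card {f \<in> ?T. f a = i})
          \<le> real (card (colorings_with_counts (A - {a}) C (k(i := k i - 1))))"
        using card_colorings_with_counts_fix_le[OF Suc.prems assms(2) a i(1)] by simp
      also have "\<dots> \<le> mode_prob ?c n * real ?c ^ n"
        using Suc.hyps(1)[OF ca] Suc.prems ca by simp
      finally show "real (card {f \<in> ?T. f a = i}) \<le> mode_prob ?c n * real ?c ^ n" .
    qed
    also have "\<dots> = real (n + 1) * (mode_prob ?c n * real ?c ^ n)"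
      using Suc by (simp flip: Suc.hyps(2))
    finally have "real (card ?T) \<le> real (n + 1) * (mode_prob ?c n * real ?c ^ n) / real (n div ?c + 1)"
      by (simp add: pos_le_divide_eq mult.commute)
    also have "\<dots> = mode_prob ?c (Suc n) * real ?c ^ Suc n"
      using c by simp
    finally show ?thesis using Suc.hyps(2) by simp
  qed
qed

text \<open>Divided by \<open>card C ^ card P\<close>, the left side is the probability that
  \<open>l\<close> and \<open>m\<close> have equal color counts. Splitting \<open>g\<close> into its
  parts off and on \<open>l - m\<close> reduces this to one multinomial bound for each outer
  part.\<close>

lemma card_equal_counts_le:
  assumes "finite P" "finite C" "C \<noteq> {}" "l \<subseteq> P" "m \<subseteq> P"
  shows "real (card {g \<in> P \<rightarrow>\<^sub>E C. \<forall>i\<in>C. card {x \<in> l. g x = i} = card {x \<in> m. g x = i}})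
    \<le> mode_prob (card C) (card (l - m)) * real (card C) ^ card P"
proof -
  define A where "A = l - m"
  let ?B = "{g \<in> P \<rightarrow>\<^sub>E C. \<forall>i\<in>C. card {x \<in> l. g x = i} = card {x \<in> m. g x = i}}"
  \<comment> \<open>All of \<open>m\<close> lies outside \<open>A\<close>, so the counts required on
    \<open>A\<close> depend only on the outer part \<open>h\<close>. The subtraction never
    truncates.\<close>
  let ?k = "\<lambda>h i. card {x \<in> m. h x = i} - card {x \<in> l \<inter> m. h x = i}"
  let ?r = "\<lambda>g. (restrict g (P - A), restrict g A)"
  let ?S = "SIGMA h : (P - A \<rightarrow>\<^sub>E C). colorings_with_counts A C (?k h)"
  have A: "finite A" "A \<subseteq> P" using assms by (auto simp: A_def intro: finite_subset)
  have fS: "finite ?S"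
    using A assms by (intro finite_SigmaI finite_PiE finite_colorings_with_counts) auto
  have "card ?B \<le> card ?S"
  proof (rule card_inj_on_le[OF _ _ fS])
    show "inj_on ?r ?B"
    proof (rule inj_onI, rule ext)
      fix f g x assume fg: "f \<in> ?B" "g \<in> ?B" "?r f = ?r g"
      have "restrict f (P - A) = restrict g (P - A)" "restrict f A = restrict g A"
        using fg(3) by simp_all
      note eq = this[THEN fun_cong, of x]
      have "f x = undefined" "g x = undefined" if "x \<notin> P"
        using fg(1,2) that by (blast intro: PiE_arb)+
      then show "f x = g x"
        using eq by (cases "x \<in> P"; cases "x \<in> A") simp_all
    qed
    show "?r ` ?B \<subseteq> ?S"
    proof (rule image_subsetI)
      fix g assume g: "g \<in> ?B"
      have "card {x \<in> A. restrict g A x = i} = ?k (restrict g (P - A)) i" if i: "i \<in> C" for i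
      proof -
        have "{x \<in> A. restrict g A x = i} = {x \<in> l. g x = i} - {x \<in> l \<inter> m. g x = i}"
          by (auto simp: A_def)
        moreover have "card \<dots> = card {x \<in> l. g x = i} - card {x \<in> l \<inter> m. g x = i}"
          using assms by (intro card_Diff_subset) (auto intro: finite_subset)
        moreover have "card {x \<in> l. g x = i} = card {x \<in> m. g x = i}" using g i by blast
        moreover have "{x \<in> m. restrict g (P - A) x = i} = {x \<in> m. g x = i}"
          "{x \<in> l \<inter> m. restrict g (P - A) x = i} = {x \<in> l \<inter> m. g x = i}"
          using assms by (auto simp: A_def)
        ultimately show ?thesis by simp
      qed
      then show "?r g \<in> ?S" using g A by (auto simp: colorings_with_counts_def)
    qed
  qed
  also have "card ?S = (\<Sum>h\<in>P - A \<rightarrow>\<^sub>E C. card (colorings_with_counts A C (?k h)))"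
    using assms A by (intro card_SigmaI ballI finite_PiE finite_colorings_with_counts) auto
  finally have "real (card ?B) \<le> (\<Sum>h\<in>P - A \<rightarrow>\<^sub>E C. real (card (colorings_with_counts A C (?k h))))"
    by (simp only: of_nat_sum[symmetric] of_nat_le_iff)
  also have "\<dots> \<le> (\<Sum>h\<in>P - A \<rightarrow>\<^sub>E C. mode_prob (card C) (card A) * real (card C) ^ card A)"
    using A assms by (intro sum_mono card_colorings_with_counts_le) auto
  also have "\<dots> = mode_prob (card C) (card A) * (real (card C) ^ card (P - A) * real (card C) ^ card A)"
    using assms by (simp add: card_PiE)
  also have "real (card C) ^ card (P - A) * real (card C) ^ card A = real (card C) ^ card P"
    using A assms by (simp add: card_Diff_subset card_mono flip: power_add)
  finally show ?thesis by (simp add: A_def)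
qed

section \<open>Decay of the largest multinomial probability\<close>

text \<open>All indices \<open>c * q + j\<close> with \<open>j < c\<close> have quotient
  \<open>q\<close>, so the denominator is constant along a block of \<open>c\<close> factors;
  \<open>i = c\<close> covers the whole block.\<close>

lemma mode_prob_add:
  assumes "i \<le> c"
  shows "mode_prob c (c * q + i) =
    mode_prob c (c * q) * (\<Prod>j<i. real (c * q + j + 1) / (real c * real (q + 1)))"
  using assms
proof (induction i)
  case (Suc i)
  then have "(c * q + i) div c = q" by simp
  then show ?case using Suc by (simp add: mult.assoc)
qed simp

lemma mode_prob_factor_le_1:
  assumes "j < c"
  shows "real (c * q + j + 1) / (real c * real (q + 1)) \<le> 1"
proof -
  have "c * q + j + 1 \<le> c * (q + 1)" using assms by simp
  then have "real (c * q + j + 1) \<le> real c * real (q + 1)"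
    by (simp only: of_nat_mult[symmetric] of_nat_le_iff)
  moreover have "0 < real c * real (q + 1)" using assms by simp
  ultimately show ?thesis by (simp only: divide_le_eq_1_pos)
qed

lemma mode_prob_add_le:
  assumes "i \<le> c"
  shows "mode_prob c (c * q + i) \<le> mode_prob c (c * q)"
proof -
  have "(\<Prod>j<i. real (c * q + j + 1) / (real c * real (q + 1))) \<le> 1"
    using assms by (intro prod_le_1 conjI mode_prob_factor_le_1) auto
  then show ?thesis
    unfolding mode_prob_add[OF assms] by (rule mult_left_le[OF _ mode_prob_nonneg])
qed

text \<open>The fourth power matches the roughly \<open>n ^ 4\<close> pairs of lines. Eight factors
  of a block already outweigh its growth from \<open>q + 1\<close> to \<open>q + 2\<close>.\<close>

lemma mode_prob_block_le:
  assumes "c \<ge> 16"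
  shows "mode_prob c (c * (q + 1)) * real (q + 2) ^ 4 \<le> mode_prob c (c * q) * real (q + 1) ^ 4"
proof -
  \<comment> \<open>Each of the first eight factors falls short of 1 by at least \<open>z\<close>,
    while \<open>(q + 2) / (q + 1) = 1 + 2 * z\<close>.\<close>
  define z where "z = 1 / (2 * real (q + 1))"
  let ?t = "\<lambda>j. real (c * q + j + 1) / (real c * real (q + 1))"
  have z: "0 \<le> z" "z \<le> 1" by (auto simp: z_def divide_simps)
  have t: "0 \<le> ?t j" "?t j \<le> 1 - z" if "j < 8" for j
  proof -
    \<comment> \<open>Here \<open>c \<ge> 16\<close> enters: the indices \<open>j < 8\<close> lie in
      the lower half of the block.\<close>
    have "2 + 2 * real j \<le> real c" using that assms by simp
    then have "2 * real (c * q + j + 1) \<le> real c * (2 * real q + 1)"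
      by (simp add: algebra_simps)
    moreover have "1 - z = real c * (2 * real q + 1) / (2 * (real c * real (q + 1)))"
      using assms by (simp add: z_def divide_simps)
    ultimately have "2 * real (c * q + j + 1) / (2 * (real c * real (q + 1))) \<le> 1 - z"
      by (simp only: divide_right_mono of_nat_0_le_iff mult_nonneg_nonneg zero_le_numeral)
    then show "?t j \<le> 1 - z" by (simp only: mult_divide_mult_cancel_left_if) simp
  qed simp
  have split: "{..<c} = {..<8} \<union> {8..<c}" using assms by auto
  have "(\<Prod>j<c. ?t j) = (\<Prod>j<8::nat. ?t j) * (\<Prod>j\<in>{8..<c}. ?t j)"
    unfolding split by (rule prod.union_disjoint) auto
  also have "\<dots> \<le> (\<Prod>j<8::nat. 1 - z) * 1"
  proof (rule mult_mono)
    show "(\<Prod>j<8::nat. ?t j) \<le> (\<Prod>j<8::nat. 1 - z)" using t by (intro prod_mono) simp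
    show "(\<Prod>j\<in>{8..<c}. ?t j) \<le> 1"
      by (intro prod_le_1 conjI mode_prob_factor_le_1) simp_all
    show "0 \<le> (\<Prod>j\<in>{8..<c}. ?t j)" by (intro prod_nonneg) simp
  qed (use z in simp)
  finally have prod: "(\<Prod>j<c. ?t j) \<le> (1 - z) ^ 8" by simp
  \<comment> \<open>As \<open>1 + 2 * z \<le> (1 + z)\<^sup>2\<close>, the four growth factors
    become eight factors \<open>1 + z\<close>, one for each \<open>1 - z\<close>.\<close>
  have "(1 - z) ^ 8 * (1 + 2 * z) ^ 4 \<le> (1 - z) ^ 8 * ((1 + z)\<^sup>2) ^ 4"
    using z by (intro mult_left_mono power_mono) (auto simp: power2_eq_square algebra_simps)
  also have "\<dots> = (1 - z\<^sup>2) ^ 8"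
  proof -
    have "1 - z\<^sup>2 = (1 - z) * (1 + z)" by (simp add: power2_eq_square algebra_simps)
    then show ?thesis by (simp add: power_mult_distrib flip: power_mult)
  qed
  also have "\<dots> \<le> 1" using z by (intro power_le_one) (auto simp: power_le_one)
  finally have le1: "(1 - z) ^ 8 * (1 + 2 * z) ^ 4 \<le> 1" .
  have q2: "real (q + 2) = (1 + 2 * z) * real (q + 1)" by (simp add: z_def field_simps)
  have "mode_prob c (c * (q + 1)) = mode_prob c (c * q) * (\<Prod>j<c. ?t j)"
    using mode_prob_add[of c c q] by (simp add: algebra_simps)
  also have "\<dots> \<le> mode_prob c (c * q) * (1 - z) ^ 8"
    using prod by (intro mult_left_mono mode_prob_nonneg)
  finally have "mode_prob c (c * (q + 1)) * real (q + 2) ^ 4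
      \<le> mode_prob c (c * q) * (1 - z) ^ 8 * real (q + 2) ^ 4"
    by (rule mult_right_mono) simp
  also have "\<dots> = mode_prob c (c * q) * real (q + 1) ^ 4 * ((1 - z) ^ 8 * (1 + 2 * z) ^ 4)"
    by (simp only: q2 power_mult_distrib mult_ac)
  also have "\<dots> \<le> mode_prob c (c * q) * real (q + 1) ^ 4"
    using le1 by (intro mult_left_le) (auto simp: mode_prob_nonneg)
  finally show ?thesis .
qed

lemma mode_prob_le_c:
  assumes "n \<le> c" "c > 0"
  shows "mode_prob c n = fact n / real c ^ n"
  using assms by (induction n) (auto simp: field_simps)

text \<open>The first factor counts ordered pairs of distinct lines. Orders below 42 are evaluated
  one by one; beyond them the block decay takes over.\<close>

lemma union_bound_42: "real ((n\<^sup>2 + n + 1) * (n\<^sup>2 + n)) * mode_prob 42 n < 1"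
proof (cases "n < 42")
  case True
  have "\<forall>n\<in>{..<42::nat}. (n\<^sup>2 + n + 1) * (n\<^sup>2 + n) * fact n < (42::nat) ^ n"
    by (simp add: lessThan_nat_numeral lessThan_Suc fact_numeral)
  then have "(n\<^sup>2 + n + 1) * (n\<^sup>2 + n) * fact n < (42::nat) ^ n" using True by simp
  then have "real ((n\<^sup>2 + n + 1) * (n\<^sup>2 + n)) * fact n < 42 ^ n"
    by (simp only: of_nat_less_iff[where 'a=real, symmetric]) simp
  then show ?thesis using True by (simp add: mode_prob_le_c field_simps)
next
  case False
  define q where "q = n div 42"
  have q: "q \<ge> 1" using False by (simp add: q_def)
  have n: "n = 42 * q + n mod 42" by (simp add: q_def)
  have le: "n + 1 \<le> 43 * (q + 1)"
  proof -
    have "n mod 42 < 42" by simp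
    then have "42 * q + n mod 42 + 1 \<le> 43 * (q + 1)" by simp
    then show ?thesis by (simp only: n[symmetric])
  qed
  \<comment> \<open>Telescoping from \<open>q = 1\<close> instead of 0 keeps the value
    \<open>mode_prob 42 42 = fact 42 / 42 ^ 42\<close>, which absorbs the constant
    \<open>43 ^ 4 * 2 ^ 4\<close> at the end.\<close>
  have G: "mode_prob 42 (42 * q) * real (q + 1) ^ 4 \<le> mode_prob 42 42 * 2 ^ 4"
    using q
  proof (induction q rule: dec_induct)
    case (step q)
    then show ?case using mode_prob_block_le[of 42 q] by simp
  qed simp
  have "(n\<^sup>2 + n + 1) * (n\<^sup>2 + n) \<le> (n + 1)\<^sup>2 * (n + 1)\<^sup>2"
    by (intro mult_le_mono) (auto simp: power2_eq_square)
  also have "\<dots> = (n + 1) ^ 4" by (simp flip: power_add)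
  also have "\<dots> \<le> (43 * (q + 1)) ^ 4" using le by (rule power_mono) simp
  finally have "real ((n\<^sup>2 + n + 1) * (n\<^sup>2 + n)) \<le> real ((43 * (q + 1)) ^ 4)"
    by (simp only: of_nat_le_iff)
  also have "\<dots> = 43 ^ 4 * real (q + 1) ^ 4" by (simp only: of_nat_power of_nat_mult power_mult_distrib) simp
  finally have "real ((n\<^sup>2 + n + 1) * (n\<^sup>2 + n)) * mode_prob 42 n
      \<le> 43 ^ 4 * real (q + 1) ^ 4 * mode_prob 42 (42 * q)"
    using mode_prob_add_le[of "n mod 42" 42 q] n
    by (intro mult_mono mode_prob_nonneg) auto
  also have "\<dots> \<le> 43 ^ 4 * (mode_prob 42 42 * 2 ^ 4)" using G by (simp add: mult.commute)
  also have "\<dots> < 1" by (simp add: mode_prob_le_c fact_numeral)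
  finally show ?thesis .
qed

section \<open>The union bound over pairs of lines\<close>

lemma line_type_eqD:
  assumes "line_type c g l = line_type c g m" "i \<in> {1..c}"
  shows "card {x \<in> l. g x = i} = card {x \<in> m. g x = i}"
proof -
  have "\<forall>j\<in>set [1..<c + 1]. card (l \<inter> g -` {j}) = card (m \<inter> g -` {j})"
    using assms(1) by (simp only: line_type_def map_eq_conv)
  moreover have "i \<in> set [1..<c + 1]" using assms(2) by auto
  ultimately have "card (l \<inter> g -` {i}) = card (m \<inter> g -` {i})" by (rule bspec)
  moreover have "k \<inter> g -` {i} = {x \<in> k. g x = i}" for k by auto
  ultimately show ?thesis by simp
qed

theorem mainTheorem4:
  fixes P :: "'a set" and L :: "'a set set"
  assumes "finite_projective_plane P L"
  shows "\<exists>g :: 'a \<Rightarrow> nat. legitimate_coloring P L 42 g"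
proof (rule ccontr)
  assume none: "\<not> ?thesis"
  interpret finite_projective_plane P L by (fact assms)
  let ?C = "{1..42} :: nat set"
  let ?B = "\<lambda>l m. {g \<in> P \<rightarrow>\<^sub>E ?C. \<forall>i\<in>?C. card {x \<in> l. g x = i} = card {x \<in> m. g x = i}}"
  let ?N = "42 ^ card P :: real"
  obtain n where n: "card L = n\<^sup>2 + n + 1" "\<And>l. l \<in> L \<Longrightarrow> card l = n + 1"
    using ex1_implies_ex[OF ex1_order] by (elim exE conjE) blast
  have B: "real (card (?B l m)) \<le> mode_prob 42 n * ?N" if "l \<in> L" "m \<in> L - {l}" for l m
  proof -
    \<comment> \<open>Distinct lines share exactly one point, so \<open>l - m\<close> has
      \<open>n\<close> points and a single bound serves all pairs.\<close>
    have "l \<noteq> m" using that by blast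
    with that have "\<exists>!p. p \<in> l \<and> p \<in> m" by (intro unique_meet) auto
    then obtain p where "p \<in> l \<and> p \<in> m" "\<forall>p'. p' \<in> l \<and> p' \<in> m \<longrightarrow> p' = p"
      by (rule ex1E)
    then have "l \<inter> m = {p}" by blast
    then have "card (l - m) = n"
      using n(2)[OF that(1)] card_Diff_subset_Int[of l m] finite_line[OF that(1)] by simp
    then show ?thesis
      using card_equal_counts_le[of P ?C l m] finite_points lines_subset that by simp
  qed
  \<comment> \<open>Without a legitimate coloring the bad events cover the whole sample space, which
    is finite because the functions are extensional.\<close>
  have "P \<rightarrow>\<^sub>E ?C \<subseteq> (\<Union>l\<in>L. \<Union>m\<in>L - {l}. ?B l m)"
  proof
    fix g assume g: "g \<in> P \<rightarrow>\<^sub>E ?C"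
    then obtain l m where "l \<in> L" "m \<in> L" "l \<noteq> m" "line_type 42 g l = line_type 42 g m"
      using none unfolding legitimate_coloring_def PiE_def by blast
    then show "g \<in> (\<Union>l\<in>L. \<Union>m\<in>L - {l}. ?B l m)"
      using g line_type_eqD[of 42 g l m] by blast
  qed
  then have "card (P \<rightarrow>\<^sub>E ?C) \<le> card (\<Union>l\<in>L. \<Union>m\<in>L - {l}. ?B l m)"
    using finite_lines finite_points by (intro card_mono) (auto intro!: finite_PiE)
  also have "\<dots> \<le> (\<Sum>l\<in>L. \<Sum>m\<in>L - {l}. card (?B l m))"
    using finite_lines by (intro order_trans[OF card_UN_le] sum_mono card_UN_le) auto
  also have "card (P \<rightarrow>\<^sub>E ?C) = 42 ^ card P"
    using finite_points by (simp add: card_PiE)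
  finally have "real (42 ^ card P) \<le> real (\<Sum>l\<in>L. \<Sum>m\<in>L - {l}. card (?B l m))"
    by (simp only: of_nat_le_iff)
  then have "?N \<le> real (\<Sum>l\<in>L. \<Sum>m\<in>L - {l}. card (?B l m))"
    by (simp only: of_nat_power of_nat_numeral)
  also have "\<dots> \<le> (\<Sum>l\<in>L. \<Sum>m\<in>L - {l}. mode_prob 42 n * ?N)"
    unfolding of_nat_sum using B by (intro sum_mono)
  \<comment> \<open>Once \<open>l\<close> is chosen, \<open>n\<^sup>2 + n\<close> lines
    \<open>m\<close> remain.\<close>
  also have "\<dots> = real ((n\<^sup>2 + n + 1) * (n\<^sup>2 + n)) * mode_prob 42 n * ?N"
    using n(1) by (simp add: mult.assoc distrib_right)
  also have "\<dots> < 1 * ?N"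
    using union_bound_42[of n] by (intro mult_strict_right_mono) auto
  finally show False by simp
qed

end
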